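(* Let $\mathcal{H}$ be a real Hilbert space, let $m\ge2$ be an integer, and let $U_1,\ldots,U_m$ be closed linear subspaces of $\mathcal{H}$ such that $U_1^\perp+\cdots+U_m^\perp$ is closed. Let $\mathcal{S}$ be a finite set of operators with $\Psi\subseteq\mathcal{S}\subseteq\Omega$, where $$\Omega=\{\mathrm{R}_{U_{i_r}}\cdots\mathrm{R}_{U_{i_2}}\mathrm{R}_{U_{i_1}} : r\in\mathbb{N},\ i_1,\ldots,i_r\in\{1,\ldots,m\}\},$$ $$\Psi=\{\mathrm{R}_{U_{i_r}}\cdots\mathrm{R}_{U_{i_2}}\mathrm{R}_{U_{i_1}} : r\in\{0,1,\ldots,m\},\ i_1,\ldots,i_r\in\{1,\ldots,m\},\ i_1<\cdots<i_r\}.$$ Set $\gamma:=\|\mathrm{P}_{U_m}\mathrm{P}_{U_{m-1}}\cdots\mathrm{P}_{U_1}\mathrm{P}_{(\cap_{i=1}^mU_i)^\perp}\|$. Then $\gamma\in[0,1[$ and, for every $x\in\mathcal{H}$ and every $k\in\mathbb{N}$, $$\|CC_{\mathcal{S}}^kx-\mathrm{P}_{\cap_{i=1}^mU_i}x\|\le\gamma^k\,\|x-\mathrm{P}_{\cap_{i=1}^mU_i}x\|.$$ Consequently, $(CC_{\mathcal{S}}^kx)_{k\in\mathbb{N}}$ converges to $\mathrm{P}_{\cap_{i=1}^mU_i}x$ with linear rate $\gamma$.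
   Context: $\mathbb{N}=\{0,1,2,\ldots\}$, and $\gamma^0=1$ also for $\gamma=0$. $\mathrm{P}_C$ is the projector (best approximation operator) onto $C$, and $\mathrm{R}_C=2\mathrm{P}_C-\mathrm{Id}$ is the reflector associated with $C$. The empty composition ($r=0$) is $\mathrm{Id}$. $C^\perp$ is the orthogonal complement; $\|\cdot\|$ of a bounded linear operator is the operator norm. Circumcenter mapping: for a finite set $\mathcal{S}$ of isometries of $\mathcal{H}$ having a common fixed point (such as a finite subset of $\Omega$), and $x\in\mathcal{H}$, let $\mathcal{S}(x)=\{Tx: T\in\mathcal{S}\}$. It is known that there is a unique point $CC_{\mathcal{S}}(x)$ that lies in the affine hull $\operatorname{aff}(\mathcal{S}(x))$ and is equidistant from all points of $\mathcal{S}(x)$; this defines the circumcenter mapping $CC_{\mathcal{S}}:\mathcal{H}\to\mathcal{H}$. $CC_{\mathcal{S}}^k$ is its $k$-fold composition. *)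

theory Defs
  imports "HOL-Analysis.Analysis"
begin

text \<open>
  Real Hilbert spaces are types of sort \<open>{real_inner, complete_space}\<close>.  The library constant
  \<open>closest_point\<close> is confined to Heine-Borel spaces, which are finite-dimensional, so the best
  approximation operator is defined again here.
\<close>

definition projector :: "'a::real_inner set \<Rightarrow> 'a \<Rightarrow> 'a" where
  "projector C x = (THE p. p \<in> C \<and> (\<forall>y\<in>C. dist x p \<le> dist x y))"

definition reflector :: "'a::real_inner set \<Rightarrow> 'a \<Rightarrow> 'a" where
  "reflector C x = 2 *\<^sub>R projector C x - x"

text \<open>
  A word \<open>w = [i\<^sub>1, \<dots>, i\<^sub>r]\<close> stands for the composition in which the factor with index \<open>i\<^sub>1\<close>
  acts first and the factor with index \<open>i\<^sub>r\<close> acts last; the empty word stands for the identity.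
\<close>

definition reflector_word :: "(nat \<Rightarrow> 'a::real_inner set) \<Rightarrow> nat list \<Rightarrow> 'a \<Rightarrow> 'a" where
  "reflector_word U w = fold (\<lambda>i. reflector (U i)) w"

definition projector_word :: "(nat \<Rightarrow> 'a::real_inner set) \<Rightarrow> nat list \<Rightarrow> 'a \<Rightarrow> 'a" where
  "projector_word U w = fold (\<lambda>i. projector (U i)) w"

definition Omega :: "(nat \<Rightarrow> 'a::real_inner set) \<Rightarrow> nat \<Rightarrow> ('a \<Rightarrow> 'a) set" where
  "Omega U m = {reflector_word U w | w. set w \<subseteq> {1..m}}"

definition Psi :: "(nat \<Rightarrow> 'a::real_inner set) \<Rightarrow> nat \<Rightarrow> ('a \<Rightarrow> 'a) set" where
  "Psi U m = {reflector_word U w | w.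
     length w \<le> m \<and> set w \<subseteq> {1..m} \<and> sorted_wrt (<) w}"

definition circumcenter_map :: "('a::real_inner \<Rightarrow> 'a) set \<Rightarrow> 'a \<Rightarrow> 'a" where
  "circumcenter_map S x =
     (THE p. p \<in> affine hull ((\<lambda>T. T x) ` S) \<and>
             (\<forall>T\<in>S. \<forall>T'\<in>S. dist p (T x) = dist p (T' x)))"

text \<open>
  Linear rate in the sense with constant equal to the initial error; it implies the
  weaker variant with an arbitrary constant in front of \<open>\<gamma> ^ k\<close>.
\<close>

definition converges_with_linear_rate ::
    "(nat \<Rightarrow> 'a::real_normed_vector) \<Rightarrow> 'a \<Rightarrow> real \<Rightarrow> bool" where
  "converges_with_linear_rate X l \<gamma> \<longleftrightarrow>
     \<gamma> \<in> {0..<1} \<and> X \<longlonglongrightarrow> l \<and> (\<forall>k. norm (X k - l) \<le> \<gamma> ^ k * norm (X 0 - l))"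

end

theory Submission
  imports Defs
begin

text \<open>
  Write \<open>M\<close> for the intersection of the subspaces and \<open>Q\<close> for the operator whose norm is \<open>\<gamma>\<close>.

  \<^emph>\<open>One step of the method.\<close>  Every product \<open>T\<close> of reflectors is an isometry that fixes the points
  of \<open>M\<close>, so a point \<open>z\<close> of \<open>M\<close> has the same distance to all the points \<open>T x\<close>.  By Pythagoras,
  the nearest point to \<open>z\<close> in the affine hull of these points is then equidistant from them as well;
  hence it is the circumcenter (\<open>circumcenter_map_nearest\<close>).  Because each projector is the average
  of the identity and a reflector, the cyclic projection \<open>P\<^sub>m \<dots> P\<^sub>1 x\<close> is an affine combination of
  the points \<open>T x\<close> with \<open>T\<close> in \<open>\<Psi>\<close>
  (\<open>projector_word_in_affine_hull_reflector_words\<close>).  So the circumcenter is at least as close to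
  the projection of \<open>x\<close> onto \<open>M\<close> as \<open>P\<^sub>m \<dots> P\<^sub>1 x\<close> is, which gives a factor \<open>\<gamma>\<close>.  The step leaves the
  projection onto \<open>M\<close> unchanged, because \<open>T x - x\<close> is orthogonal to \<open>M\<close> for every \<open>T\<close>; hence the
  estimate can be iterated.

  \<^emph>\<open>The bound \<open>\<gamma> < 1\<close>.\<close>  When the sum of the orthogonal complements is closed, it equals the orthogonal
  complement of \<open>M\<close>.  Those vectors of this complement that lie within distance 1 of every subspace
  then form a weakly bounded set, so the uniform boundedness principle bounds their norms: a vector
  orthogonal to \<open>M\<close> that is near every \<open>U i\<close> is small (\<open>linear_regularity\<close>).  On the other hand, if a cyclic
  projection loses little norm, all of its steps are short, so the vector was near every \<open>U i\<close>
  (\<open>norm_diff_projector_le_loss\<close>).  Together, these two facts force a fixed relative loss of norm on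
  the complement of \<open>M\<close>.
\<close>

section \<open>Orthogonal projections\<close>

text \<open>
  A minimizing sequence for the distance is Cauchy by the parallelogram law, and the residual at
  its limit is orthogonal to the subspace because of minimality.
\<close>

lemma orthogonal_projection_exists:
  fixes V :: "'a::{real_inner, complete_space} set"
  assumes V: "subspace V" "closed V"
  shows "\<exists>p\<in>V. \<forall>y\<in>V. inner (x - p) y = 0"
proof -
  define d where "d = infdist x V"
  have ne: "V \<noteq> {}" using subspace_0[OF V(1)] by auto
  have d_le: "d \<le> dist x y" if "y \<in> V" for y
    using infdist_le[OF that] by (simp add: d_def)
  have d0: "d \<ge> 0" by (simp add: d_def infdist_nonneg)
  have "\<exists>p\<in>V. dist x p < d + 1 / Suc n" for n
  proof (rule ccontr)
    assume "\<not> ?thesis"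
    then have "d + 1 / Suc n \<le> dist x p" if "p \<in> V" for p using that by force
    then have "d + 1 / Suc n \<le> (INF a\<in>V. dist x a)"
      using ne by (intro cINF_greatest) auto
    then show False using ne by (simp add: d_def infdist_def)
  qed
  then obtain p where p: "\<And>n. p n \<in> V" "\<And>n. dist x (p n) < d + 1 / Suc n"
    by metis
  have sq: "(dist x (p n))\<^sup>2 \<le> d\<^sup>2 + (2 * d + 1) * (1 / Suc n)" for n
  proof -
    define e where "e = 1 / real (Suc n)"
    have e: "0 \<le> e" "e \<le> 1" by (auto simp: e_def)
    have "(dist x (p n))\<^sup>2 \<le> (d + e)\<^sup>2"
      using p(2)[of n] by (intro power_mono) (auto simp: e_def)
    also have "\<dots> \<le> d\<^sup>2 + (2 * d + 1) * e"
      using mult_left_mono[OF e(2) e(1)] by (simp add: power2_eq_square algebra_simps)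
    finally show ?thesis by (simp add: e_def)
  qed
  \<comment> \<open>parallelogram law at the midpoint, which lies in \<open>V\<close> and so has distance at least \<open>d\<close>\<close>
  have par: "(dist (p j) (p k))\<^sup>2 \<le> 2 * (2 * d + 1) * (1 / Suc j + 1 / Suc k)" for j k
  proof -
    have "(1/2) *\<^sub>R (p j + p k) \<in> V"
      using p(1) V(1) by (intro subspace_scale subspace_add)
    then have mid: "d\<^sup>2 \<le> (dist x ((1/2) *\<^sub>R (p j + p k)))\<^sup>2"
      using d_le d0 by (intro power_mono) auto
    have law: "(dist (p j) (p k))\<^sup>2
        = 2 * (dist x (p j))\<^sup>2 + 2 * (dist x (p k))\<^sup>2 - 4 * (dist x ((1/2) *\<^sub>R (p j + p k)))\<^sup>2"
      by (simp add: dist_norm power2_norm_eq_inner algebra_simps inner_commute)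
    have "(dist (p j) (p k))\<^sup>2
        \<le> 2 * (d\<^sup>2 + (2 * d + 1) * (1 / Suc j)) + 2 * (d\<^sup>2 + (2 * d + 1) * (1 / Suc k)) - 4 * d\<^sup>2"
      unfolding law by (intro diff_mono add_mono mult_left_mono sq mid) auto
    also have "\<dots> = 2 * (2 * d + 1) * (1 / Suc j + 1 / Suc k)" by (simp add: algebra_simps)
    finally show ?thesis .
  qed
  have "Cauchy p"
  proof (rule metric_CauchyI)
    fix e :: real assume e: "e > 0"
    \<comment> \<open>chosen so that \<open>par\<close> with both reciprocals below \<open>b\<close> yields exactly \<open>e\<^sup>2\<close>\<close>
    define b where "b = e\<^sup>2 / (4 * (2 * d + 1))"
    have b: "b > 0" using e d0 by (simp add: b_def)
    obtain N where N: "1 / Suc N < b"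
      using nat_approx_posE[OF b] by auto
    have "dist (p j) (p k) < e" if "j \<ge> N" "k \<ge> N" for j k
    proof -
      have "1 / Suc j \<le> 1 / Suc N" "1 / Suc k \<le> 1 / Suc N"
        using that by (auto intro!: divide_left_mono)
      then have "1 / Suc j + 1 / Suc k < 2 * b" using N by linarith
      then have "2 * (2 * d + 1) * (1 / Suc j + 1 / Suc k) < 2 * (2 * d + 1) * (2 * b)"
        using d0 by (intro mult_strict_left_mono) auto
      also have "\<dots> = e\<^sup>2" using d0 by (simp add: b_def field_simps)
      finally have "(dist (p j) (p k))\<^sup>2 < e\<^sup>2" using par[of j k] by linarith
      then show ?thesis using e by (simp add: power_less_imp_less_base)
    qed
    then show "\<exists>M. \<forall>m\<ge>M. \<forall>n\<ge>M. dist (p m) (p n) < e" by blast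
  qed
  then obtain q where q: "p \<longlonglongrightarrow> q"
    using Cauchy_convergent convergent_def by blast
  have qV: "q \<in> V" using closed_sequentially[OF V(2) _ q] p(1) by blast
  have "(\<lambda>n. d + 1 / Suc n) \<longlonglongrightarrow> d + 0"
    by (intro tendsto_intros LIMSEQ_Suc[OF lim_1_over_n])
  moreover have "(\<lambda>n. dist x (p n)) \<longlonglongrightarrow> dist x q"
    by (intro tendsto_intros q)
  ultimately have "dist x q \<le> d + 0"
    using p(2) by (intro LIMSEQ_le) (auto intro!: exI[of _ 0] less_imp_le)
  then have min: "norm (x - q) \<le> norm (x - y)" if "y \<in> V" for y
    using d_le[OF that] by (simp add: dist_norm)
  have "inner (x - q) y = 0" if y: "y \<in> V" for y
  proof (cases "y = 0")
    case False
    \<comment> \<open>moving \<open>q\<close> along \<open>y\<close> by the optimal amount cannot decrease the distance\<close>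
    define t where "t = inner (x - q) y / inner y y"
    have "norm (x - q) \<le> norm (x - (q + t *\<^sub>R y))"
      using y qV V(1) by (intro min subspace_add subspace_scale)
    then have "inner (x - q) (x - q) \<le> inner (x - (q + t *\<^sub>R y)) (x - (q + t *\<^sub>R y))"
      by (simp add: norm_le)
    also have "\<dots> = inner (x - q) (x - q) - 2 * t * inner (x - q) y + t * t * inner y y"
      by (simp add: algebra_simps inner_commute)
    also have "t * t * inner y y = t * inner (x - q) y"
      using False by (simp add: t_def)
    finally have "t * inner (x - q) y \<le> 0" by simp
    then have "(inner (x - q) y)\<^sup>2 / inner y y \<le> 0"
      by (simp add: t_def power2_eq_square)
    moreover have "inner y y > 0" using False by simp
    ultimately have "(inner (x - q) y)\<^sup>2 \<le> 0"
      by (simp only: divide_le_0_iff) auto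
    then show ?thesis by simp
  qed simp
  with qV show ?thesis by blast
qed

lemma dist_pythagoras:
  assumes "inner (x - p) (y - p) = 0"
  shows "(dist x y)\<^sup>2 = (dist x p)\<^sup>2 + (dist y p)\<^sup>2"
  using assms
  by (simp add: dist_norm power2_norm_eq_inner algebra_simps inner_commute)

text \<open>
  Orthogonality of the residual characterizes the projector; all later facts about it are obtained
  from this rather than from minimality.
\<close>
lemma projector_eqI:
  assumes V: "subspace V" and p: "p \<in> V" "\<And>y. y \<in> V \<Longrightarrow> inner (x - p) y = 0"
  shows "projector V x = p"
proof -
  have pyth: "(dist x y)\<^sup>2 = (dist x p)\<^sup>2 + (dist y p)\<^sup>2" if "y \<in> V" for y
    using p that V by (intro dist_pythagoras) (simp add: subspace_diff)
  show ?thesis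
    unfolding projector_def
  proof (rule the_equality, intro conjI ballI)
    fix y assume "y \<in> V"
    then have "(dist x p)\<^sup>2 \<le> (dist x y)\<^sup>2" using pyth by simp
    then show "dist x p \<le> dist x y" by (rule power2_le_imp_le) simp
  next
    fix q assume q: "q \<in> V \<and> (\<forall>y\<in>V. dist x q \<le> dist x y)"
    then have "dist x q \<le> dist x p" using p by blast
    then have "(dist x q)\<^sup>2 \<le> (dist x p)\<^sup>2" by (intro power_mono) auto
    with pyth[of q] q have "(dist q p)\<^sup>2 \<le> 0" by auto
    then show "q = p" by simp
  qed (fact p)
qed

lemma projector_mem:
  fixes V :: "'a::{real_inner, complete_space} set"
  assumes V: "subspace V" "closed V"
  shows "projector V x \<in> V"
  using orthogonal_projection_exists[OF V, of x] projector_eqI[OF V(1)] by blast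

lemma projector_orthogonal:
  fixes V :: "'a::{real_inner, complete_space} set"
  assumes V: "subspace V" "closed V" and "y \<in> V"
  shows "inner (x - projector V x) y = 0"
  using orthogonal_projection_exists[OF V, of x] projector_eqI[OF V(1)] assms(3) by blast

lemma projector_ident: "subspace V \<Longrightarrow> x \<in> V \<Longrightarrow> projector V x = x"
  by (rule projector_eqI) auto

lemma norm_projector_pythagoras:
  fixes V :: "'a::{real_inner, complete_space} set"
  assumes "subspace V" "closed V"
  shows "(norm x)\<^sup>2 = (norm (projector V x))\<^sup>2 + (norm (x - projector V x))\<^sup>2"
  using projector_orthogonal[OF assms projector_mem[OF assms, of x], of x]
  by (simp add: power2_norm_eq_inner algebra_simps inner_commute)

lemma norm_projector_le:
  fixes V :: "'a::{real_inner, complete_space} set"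
  assumes "subspace V" "closed V"
  shows "norm (projector V x) \<le> norm x"
  by (rule power2_le_imp_le) (use norm_projector_pythagoras[OF assms, of x] in auto)

lemma norm_diff_projector_le:
  fixes V :: "'a::{real_inner, complete_space} set"
  assumes "subspace V" "closed V" and "y \<in> V"
  shows "norm (x - projector V x) \<le> norm (x - y)"
proof -
  have "inner (x - projector V x) (y - projector V x) = 0"
    using assms by (intro projector_orthogonal subspace_diff projector_mem)
  then have "(norm (x - y))\<^sup>2 = (norm (x - projector V x))\<^sup>2 + (norm (y - projector V x))\<^sup>2"
    using dist_pythagoras by (simp add: dist_norm)
  then have "(norm (x - projector V x))\<^sup>2 \<le> (norm (x - y))\<^sup>2" by simp
  then show ?thesis by (rule power2_le_imp_le) simp
qed

lemma bounded_linear_projector: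
  fixes V :: "'a::{real_inner, complete_space} set"
  assumes V: "subspace V" "closed V"
  shows "bounded_linear (projector V)"
proof (rule bounded_linear_intro)
  fix x y and r :: real
  have "inner (x + y - (projector V x + projector V y)) z = 0" if "z \<in> V" for z
    using projector_orthogonal[OF V that, of x] projector_orthogonal[OF V that, of y]
    by (simp add: algebra_simps)
  then show "projector V (x + y) = projector V x + projector V y"
    by (intro projector_eqI V subspace_add projector_mem)
  have "inner (r *\<^sub>R x - r *\<^sub>R projector V x) z = 0" if "z \<in> V" for z
    using projector_orthogonal[OF V that, of x]
    by (metis inner_scaleR_left mult_zero_right scaleR_diff_right)
  then show "projector V (r *\<^sub>R x) = r *\<^sub>R projector V x"
    by (intro projector_eqI V subspace_scale projector_mem)
  show "norm (projector V x) \<le> norm x * 1"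
    using norm_projector_le[OF V] by simp
qed

lemma closed_orthogonal_comp: "closed (orthogonal_comp W)"
proof -
  have "orthogonal_comp W = (\<Inter>y\<in>W. {x. inner y x = 0})"
    by (auto simp: orthogonal_comp_def orthogonal_def)
  then show ?thesis by (auto intro!: closed_INT closed_hyperplane)
qed

lemma orthogonal_comp_orthogonal_comp_closed:
  fixes V :: "'a::{real_inner, complete_space} set"
  assumes V: "subspace V" "closed V"
  shows "orthogonal_comp (orthogonal_comp V) = V"
proof
  show "orthogonal_comp (orthogonal_comp V) \<subseteq> V"
  proof
    fix x assume x: "x \<in> orthogonal_comp (orthogonal_comp V)"
    have o: "inner (x - projector V x) z = 0" if "z \<in> V" for z
      by (rule projector_orthogonal[OF V that])
    then have "x - projector V x \<in> orthogonal_comp V"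
      by (auto simp: orthogonal_comp_def orthogonal_def inner_commute)
    with x have "inner (x - projector V x) x = 0"
      by (auto simp: orthogonal_comp_def orthogonal_def)
    with o[OF projector_mem[OF V, of x]]
    have "inner (x - projector V x) (x - projector V x) = 0"
      by (simp add: inner_diff_right)
    then show "x \<in> V" using projector_mem[OF V, of x] by simp
  qed
qed (rule orthogonal_comp_subset)

lemma diff_projector_orthogonal_comp:
  fixes V :: "'a::{real_inner, complete_space} set"
  assumes "subspace V" "closed V"
  shows "x - projector V x \<in> orthogonal_comp V"
  using projector_orthogonal[OF assms]
  by (auto simp: orthogonal_comp_def orthogonal_def inner_commute)

section \<open>Linear regularity of subspaces whose complements have a closed sum\<close>

text \<open>
  This is the uniform boundedness principle for the functionals \<open>inner x\<close> with \<open>x \<in> A\<close>: by Baire, they are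
  jointly bounded on some ball, and testing at two points of the ball that differ by a multiple of
  \<open>x\<close> bounds the norm of \<open>x\<close>.
\<close>
lemma weakly_bounded_imp_bounded:
  fixes A :: "'a::{real_inner, complete_space} set"
  assumes "\<And>y. \<exists>c. \<forall>x\<in>A. \<bar>inner x y\<bar> \<le> c"
  shows "bounded A"
proof -
  define F where "F n = {y. \<forall>x\<in>A. \<bar>inner x y\<bar> \<le> real n}" for n :: nat
  have F_alt: "F n = (\<Inter>x\<in>A. {y. \<bar>inner x y\<bar> \<le> real n})" for n
    by (auto simp: F_def)
  have cl: "closed (F n)" for n
    unfolding F_alt by (intro closed_INT ballI closed_Collect_le continuous_intros)
  have "(\<Union>n. F n) = UNIV"
  proof -
    have "\<exists>n. y \<in> F n" for y
    proof -
      obtain c where "\<forall>x\<in>A. \<bar>inner x y\<bar> \<le> c" using assms by blast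
      moreover obtain n where "c \<le> real n" using real_arch_simple by blast
      ultimately have "y \<in> F n" unfolding F_def by force
      then show ?thesis ..
    qed
    then show ?thesis by blast
  qed
  have "\<exists>n. interior (F n) \<noteq> {}"
  proof (rule ccontr)
    assume "\<nexists>n. interior (F n) \<noteq> {}"
    then have "euclidean interior_of (\<Union>(range F)) = {}"
      using cl by (intro Baire_category_alt) (auto simp: completely_metrizable_space_euclidean)
    then show False using \<open>(\<Union>n. F n) = UNIV\<close> by simp
  qed
  then obtain n a where "a \<in> interior (F n)" by blast
  then obtain e where e: "e > 0" "cball a e \<subseteq> F n"
    using mem_interior_cball by blast
  have "norm x \<le> 2 * n / e" if x: "x \<in> A" for x
  proof (cases "x = 0")
    case False
    \<comment> \<open>the step from the centre to the boundary of the ball in the direction of \<open>x\<close>\<close>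
    define u where "u = (e / norm x) *\<^sub>R x"
    have "norm u = e" using e False by (simp add: u_def)
    then have "a \<in> F n" "a + u \<in> F n" using e by (auto simp: subset_iff dist_norm)
    then have "\<bar>inner x a\<bar> \<le> n" "\<bar>inner x (a + u)\<bar> \<le> n" using x by (auto simp: F_def)
    then have "inner x u \<le> 2 * n" by (simp add: inner_add_right)
    also have "inner x u = e * norm x"
      using False by (simp add: u_def power2_norm_eq_inner[symmetric] power2_eq_square)
    finally show ?thesis using e by (simp add: field_simps)
  qed (use e in auto)
  then show ?thesis by (auto simp: bounded_iff)
qed

text \<open>
  The residual of the projection of \<open>y\<close> onto the sum \<open>W\<close> of the complements is orthogonal to each
  of them, so it lies in the intersection of the double complements, that is, of the \<open>U i\<close>.  Since \<open>y\<close> is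
  orthogonal to that intersection, the residual vanishes.  Closedness of \<open>W\<close> is what makes
  the projection onto \<open>W\<close> available.
\<close>
lemma orthogonal_comp_INT_decompose:
  fixes U :: "'i \<Rightarrow> 'a::{real_inner, complete_space} set"
  assumes I: "finite I"
    and U: "\<And>i. i \<in> I \<Longrightarrow> subspace (U i)" "\<And>i. i \<in> I \<Longrightarrow> closed (U i)"
    and cl: "closed (\<Sum>i\<in>I. orthogonal_comp (U i))"
    and y: "y \<in> orthogonal_comp (\<Inter>i\<in>I. U i)"
  obtains v where "\<And>i. i \<in> I \<Longrightarrow> v i \<in> orthogonal_comp (U i)" "y = (\<Sum>i\<in>I. v i)"
proof -
  define W where "W = (\<Sum>i\<in>I. orthogonal_comp (U i))"
  have W_alt: "W = {sum s I |s. \<forall>i\<in>I. s i \<in> orthogonal_comp (U i)}"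
    unfolding W_def by (rule set_sum_alt[OF I])
  have sub: "subspace W"
  proof (rule subspaceI)
    show "0 \<in> W"
      unfolding W_alt
      by (rule CollectI, rule exI[of _ "\<lambda>_. 0"]) (simp add: subspace_0 subspace_orthogonal_comp)
  next
    fix a b assume "a \<in> W" "b \<in> W"
    then obtain s t where "a = sum s I" "b = sum t I"
      "\<forall>i\<in>I. s i \<in> orthogonal_comp (U i)" "\<forall>i\<in>I. t i \<in> orthogonal_comp (U i)"
      unfolding W_alt by blast
    then show "a + b \<in> W"
      unfolding W_alt
      by (intro CollectI exI[of _ "\<lambda>i. s i + t i"])
        (simp add: sum.distrib subspace_add subspace_orthogonal_comp)
  next
    fix c a assume "a \<in> W"
    then obtain s where "a = sum s I" "\<forall>i\<in>I. s i \<in> orthogonal_comp (U i)"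
      unfolding W_alt by blast
    then show "c *\<^sub>R a \<in> W"
      unfolding W_alt
      by (intro CollectI exI[of _ "\<lambda>i. c *\<^sub>R s i"])
        (simp add: scaleR_sum_right subspace_scale subspace_orthogonal_comp)
  qed
  have clW: "closed W" using cl by (simp add: W_def)
  define r where "r = y - projector W y"
  have rW: "inner r w = 0" if "w \<in> W" for w
    unfolding r_def by (rule projector_orthogonal[OF sub clW that])
  have "r \<in> U i" if i: "i \<in> I" for i
  proof -
    have "inner r z = 0" if z: "z \<in> orthogonal_comp (U i)" for z
    proof (rule rW)
      have "(\<Sum>j\<in>I. if j = i then z else 0) = z" using I i by simp
      then show "z \<in> W"
        unfolding W_alt using z
        by (intro CollectI exI[of _ "\<lambda>j. if j = i then z else 0"])
          (simp add: subspace_0 subspace_orthogonal_comp)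
    qed
    then have "r \<in> orthogonal_comp (orthogonal_comp (U i))"
      by (auto simp: orthogonal_comp_def orthogonal_def inner_commute)
    then show ?thesis using orthogonal_comp_orthogonal_comp_closed U i by blast
  qed
  then have "inner r y = 0"
    using y by (auto simp: orthogonal_comp_def orthogonal_def)
  moreover have "inner r (projector W y) = 0"
    by (intro rW projector_mem sub clW)
  ultimately have "inner r r = 0"
    by (simp add: r_def inner_diff_right)
  then have "y \<in> W" using projector_mem[OF sub clW, of y] by (simp add: r_def)
  then show ?thesis using that unfolding W_alt by blast
qed

text \<open>
  If \<open>x\<close> is orthogonal to the intersection, then \<open>inner x y\<close> depends only on the component of \<open>y\<close> orthogonal
  to the intersection.  That component is a sum of vectors \<open>v i\<close> from the complements, and \<open>v i\<close>
  sees only the residual of \<open>x\<close> at \<open>U i\<close>.  So the set of such \<open>x\<close> with residuals at most 1 is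
  weakly bounded; the general bound follows by scaling.
\<close>
lemma linear_regularity:
  fixes U :: "'i \<Rightarrow> 'a::{real_inner, complete_space} set"
  assumes I: "finite I"
    and U: "\<And>i. i \<in> I \<Longrightarrow> subspace (U i)" "\<And>i. i \<in> I \<Longrightarrow> closed (U i)"
    and cl: "closed (\<Sum>i\<in>I. orthogonal_comp (U i))"
  obtains K where "K \<ge> 1"
    "\<And>x \<delta>. x \<in> orthogonal_comp (\<Inter>i\<in>I. U i) \<Longrightarrow> 0 \<le> \<delta> \<Longrightarrow>
      (\<And>i. i \<in> I \<Longrightarrow> norm (x - projector (U i) x) \<le> \<delta>) \<Longrightarrow> norm x \<le> K * \<delta>"
proof -
  define N where "N = orthogonal_comp (\<Inter>i\<in>I. U i)"
  define A where "A = {x \<in> N. \<forall>i\<in>I. norm (x - projector (U i) x) \<le> 1}"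
  have N: "subspace N" "closed N"
    by (auto simp: N_def subspace_orthogonal_comp closed_orthogonal_comp)
  have "bounded A"
  proof (rule weakly_bounded_imp_bounded)
    fix y
    obtain v where v: "\<And>i. i \<in> I \<Longrightarrow> v i \<in> orthogonal_comp (U i)" "projector N y = (\<Sum>i\<in>I. v i)"
      using orthogonal_comp_INT_decompose[OF I U cl] projector_mem[OF N, of y]
      unfolding N_def by blast
    have "\<bar>inner x y\<bar> \<le> (\<Sum>i\<in>I. norm (v i))" if x: "x \<in> A" for x
    proof -
      have "inner x y = inner x (projector N y)"
        using projector_orthogonal[OF N, of x y] x
        by (simp add: A_def inner_diff_right inner_commute)
      also have "\<dots> = (\<Sum>i\<in>I. inner x (v i))" by (simp add: v inner_sum_right)
      also have "\<dots> = (\<Sum>i\<in>I. inner (x - projector (U i) x) (v i))"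
      proof (rule sum.cong)
        fix i assume i: "i \<in> I"
        then have "inner (projector (U i) x) (v i) = 0"
          using v(1)[OF i] projector_mem[OF U, of i x]
          by (auto simp: orthogonal_comp_def orthogonal_def)
        then show "inner x (v i) = inner (x - projector (U i) x) (v i)"
          by (simp add: inner_diff_left)
      qed simp
      also have "\<bar>\<dots>\<bar> \<le> (\<Sum>i\<in>I. norm (v i))"
      proof (rule order_trans[OF sum_abs], rule sum_mono)
        fix i assume "i \<in> I"
        then have "norm (x - projector (U i) x) * norm (v i) \<le> 1 * norm (v i)"
          using x by (intro mult_right_mono) (auto simp: A_def)
        then show "\<bar>inner (x - projector (U i) x) (v i)\<bar> \<le> norm (v i)"
          using Cauchy_Schwarz_ineq2[of "x - projector (U i) x" "v i"] by linarith
      qed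
      finally show ?thesis .
    qed
    then show "\<exists>c. \<forall>x\<in>A. \<bar>inner x y\<bar> \<le> c" by blast
  qed
  then obtain K0 where K0: "\<And>x. x \<in> A \<Longrightarrow> norm x \<le> K0"
    by (auto simp: bounded_iff)
  define K where "K = max K0 1"
  show ?thesis
  proof (rule that[of K])
    fix x and \<delta> :: real
    assume "x \<in> orthogonal_comp (\<Inter>i\<in>I. U i)" and \<delta>: "0 \<le> \<delta>"
      and near: "\<And>i. i \<in> I \<Longrightarrow> norm (x - projector (U i) x) \<le> \<delta>"
    then have x: "x \<in> N" by (simp add: N_def)
    show "norm x \<le> K * \<delta>"
    proof (cases "\<delta> = 0")
      case True
      then have "x \<in> U i" if "i \<in> I" for i
        using near[OF that] projector_mem[OF U, OF that that, of x] by simp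
      then have "inner x x = 0"
        using x by (auto simp: N_def orthogonal_comp_def orthogonal_def)
      with True show ?thesis by simp
    next
      case False
      with \<delta> have pos: "\<delta> > 0" by simp
      have "inverse \<delta> *\<^sub>R x \<in> A"
        unfolding A_def
      proof (intro CollectI conjI ballI)
        show "inverse \<delta> *\<^sub>R x \<in> N" using N x by (simp add: subspace_scale)
        fix i assume i: "i \<in> I"
        interpret P: bounded_linear "projector (U i)"
          using bounded_linear_projector U i by blast
        have "norm (inverse \<delta> *\<^sub>R x - projector (U i) (inverse \<delta> *\<^sub>R x))
            = inverse \<delta> * norm (x - projector (U i) x)"
          using pos by (simp add: P.scaleR scaleR_diff_right[symmetric])
        also have "\<dots> \<le> inverse \<delta> * \<delta>"
          using near[OF i] pos by (intro mult_left_mono) auto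
        finally show "norm (inverse \<delta> *\<^sub>R x - projector (U i) (inverse \<delta> *\<^sub>R x)) \<le> 1"
          using pos by simp
      qed
      then have "norm (inverse \<delta> *\<^sub>R x) \<le> K" using K0 by (force simp: K_def)
      then show ?thesis using pos by (simp add: field_simps)
    qed
  qed (simp add: K_def)
qed

section \<open>Cyclic projections contract on the complement of the intersection\<close>

lemma projector_word_Nil [simp]: "projector_word U [] x = x"
  and projector_word_Cons [simp]:
    "projector_word U (i # w) x = projector_word U w (projector (U i) x)"
  and reflector_word_Nil [simp]: "reflector_word U [] x = x"
  and reflector_word_Cons [simp]:
    "reflector_word U (i # w) x = reflector_word U w (reflector (U i) x)"
  by (auto simp: projector_word_def reflector_word_def)

lemma bounded_linear_projector_word:
  fixes U :: "nat \<Rightarrow> 'a::{real_inner, complete_space} set"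
  assumes "\<And>i. i \<in> set w \<Longrightarrow> subspace (U i)" "\<And>i. i \<in> set w \<Longrightarrow> closed (U i)"
  shows "bounded_linear (projector_word U w)"
  using assms
proof (induction w)
  case Nil
  have "projector_word U [] = (\<lambda>x. x)" by auto
  then show ?case by (simp add: bounded_linear_ident)
next
  case (Cons i w)
  have "projector_word U (i # w) = (\<lambda>x. projector_word U w (projector (U i) x))" by auto
  then show ?case
    using Cons
    by (auto intro!: bounded_linear_compose[of "projector_word U w"] bounded_linear_projector)
qed

lemma projector_word_ident:
  assumes "\<And>i. i \<in> set w \<Longrightarrow> subspace (U i)" "\<And>i. i \<in> set w \<Longrightarrow> z \<in> U i"
  shows "projector_word U w z = z"
  using assms by (induction w) (auto simp: projector_ident)

text \<open>
  By Pythagoras, the squared lengths of the successive steps sum to the loss of the squared norm,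
  and \<open>U i\<close> is reached after at most \<open>length w\<close> steps; the factor \<open>length w\<close> comes from the
  Cauchy--Schwarz inequality between the sum of the lengths and the sum of their squares.
\<close>
lemma norm_diff_projector_le_loss:
  fixes U :: "nat \<Rightarrow> 'a::{real_inner, complete_space} set"
  assumes "\<And>i. i \<in> set w \<Longrightarrow> subspace (U i)" "\<And>i. i \<in> set w \<Longrightarrow> closed (U i)"
  shows "norm (projector_word U w x) \<le> norm x \<and>
    (\<forall>i\<in>set w. (norm (x - projector (U i) x))\<^sup>2
      \<le> length w * ((norm x)\<^sup>2 - (norm (projector_word U w x))\<^sup>2))"
  using assms
proof (induction w arbitrary: x)
  case (Cons i w)
  define x1 where "x1 = projector (U i) x"
  define y where "y = projector_word U w x1"
  define n where "n = real (length w)"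
  define s where "s = (norm x1)\<^sup>2 - (norm y)\<^sup>2"
  define \<delta> where "\<delta> = norm (x - x1)"
  have Ui: "subspace (U i)" "closed (U i)" using Cons.prems by auto
  have IH: "norm y \<le> norm x1"
    "\<And>j. j \<in> set w \<Longrightarrow> (norm (x1 - projector (U j) x1))\<^sup>2 \<le> n * s"
    using Cons by (auto simp: y_def n_def s_def)
  have s0: "s \<ge> 0" using IH(1) by (simp add: s_def)
  have tot: "(norm x)\<^sup>2 - (norm y)\<^sup>2 = \<delta>\<^sup>2 + s"
    using norm_projector_pythagoras[OF Ui, of x] by (simp add: s_def \<delta>_def x1_def)
  have n0: "n \<ge> 0" by (simp add: n_def)
  have "(norm (x - projector (U j) x))\<^sup>2 \<le> (1 + n) * (\<delta>\<^sup>2 + s)" if j: "j \<in> set (i # w)" for j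
  proof (cases "j = i")
    case True
    have "1 * \<delta>\<^sup>2 \<le> (1 + n) * (\<delta>\<^sup>2 + s)" using n0 s0 by (intro mult_mono) auto
    then show ?thesis by (simp add: True \<delta>_def x1_def)
  next
    case False
    then have jw: "j \<in> set w" using j by auto
    define t where "t = norm (x1 - projector (U j) x1)"
    have n1: "n > 0" using jw by (auto simp: n_def)
    have Uj: "subspace (U j)" "closed (U j)" using Cons.prems j by auto
    have "norm (x - projector (U j) x) \<le> norm (x - projector (U j) x1)"
      by (intro norm_diff_projector_le projector_mem Uj)
    also have "\<dots> \<le> \<delta> + t"
      using norm_triangle_ineq[of "x - x1" "x1 - projector (U j) x1"]
      by (simp add: \<delta>_def t_def)
    finally have "(norm (x - projector (U j) x))\<^sup>2 \<le> (\<delta> + t)\<^sup>2" by (intro power_mono) auto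
    also have "\<dots> \<le> (1 + n) * (\<delta>\<^sup>2 + s)"
    proof -
      have t: "t\<^sup>2 \<le> n * s" using IH(2)[OF jw] by (simp add: t_def)
      \<comment> \<open>the square completed here gives \<open>(\<delta> + t)\<^sup>2 \<le> (1 + n) * (\<delta>\<^sup>2 + t\<^sup>2 / n)\<close>\<close>
      have "0 \<le> (n * \<delta> - t)\<^sup>2" by simp
      also have "(n * \<delta> - t)\<^sup>2 \<le> n * (n * \<delta>\<^sup>2 + s - 2 * \<delta> * t)"
        using t by (simp add: power2_eq_square algebra_simps)
      finally have "2 * \<delta> * t \<le> n * \<delta>\<^sup>2 + s"
        using n1 by (simp add: zero_le_mult_iff)
      with t show ?thesis by (simp add: power2_eq_square algebra_simps)
    qed
    finally show ?thesis .
  qed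
  moreover have "norm y \<le> norm x"
    using IH(1) norm_projector_le[OF Ui, of x] by (simp add: x1_def)
  moreover have word: "projector_word U (i # w) x = y" by (simp add: y_def x1_def)
  moreover have len: "real (length (i # w)) = 1 + n" by (simp add: n_def)
  ultimately show ?case unfolding word len tot by blast
qed simp

lemma projector_word_contraction:
  fixes U :: "nat \<Rightarrow> 'a::{real_inner, complete_space} set"
  assumes U: "\<And>i. i \<in> set w \<Longrightarrow> subspace (U i)" "\<And>i. i \<in> set w \<Longrightarrow> closed (U i)"
    and cl: "closed (\<Sum>i\<in>set w. orthogonal_comp (U i))"
  obtains c where "0 \<le> c" "c < 1"
    "\<And>x. x \<in> orthogonal_comp (\<Inter>i\<in>set w. U i) \<Longrightarrow> norm (projector_word U w x) \<le> c * norm x"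
proof -
  obtain K where K: "K \<ge> 1"
    "\<And>x \<delta>. x \<in> orthogonal_comp (\<Inter>i\<in>set w. U i) \<Longrightarrow> 0 \<le> \<delta> \<Longrightarrow>
      (\<And>i. i \<in> set w \<Longrightarrow> norm (x - projector (U i) x) \<le> \<delta>) \<Longrightarrow> norm x \<le> K * \<delta>"
    by (rule linear_regularity[OF finite_set U cl]) auto
  \<comment> \<open>\<open>1 + length w\<close> instead of \<open>length w\<close> keeps \<open>L \<ge> 1\<close> for the empty word\<close>
  define L where "L = K\<^sup>2 * (1 + real (length w))"
  have "1 \<le> K\<^sup>2" using K(1) by simp
  then have L: "L \<ge> 1" unfolding L_def
    using mult_mono[of 1 "K\<^sup>2" 1 "1 + real (length w)"] by simp
  show ?thesis
  proof (rule that[of "sqrt (1 - 1 / L)"])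
    show "0 \<le> sqrt (1 - 1 / L)" "sqrt (1 - 1 / L) < 1" using L by auto
    fix x assume x: "x \<in> orthogonal_comp (\<Inter>i\<in>set w. U i)"
    define y where "y = projector_word U w x"
    define q where "q = (norm x)\<^sup>2 - (norm y)\<^sup>2"
    have le: "norm y \<le> norm x"
      and near: "\<And>i. i \<in> set w \<Longrightarrow> (norm (x - projector (U i) x))\<^sup>2 \<le> length w * q"
      using norm_diff_projector_le_loss[of w U x, OF U] by (auto simp: y_def q_def)
    have q0: "q \<ge> 0" using le by (simp add: q_def)
    have "norm x \<le> K * sqrt (length w * q)"
      using near q0 by (intro K(2) x) (auto intro: real_le_rsqrt)
    then have "(norm x)\<^sup>2 \<le> (K * sqrt (length w * q))\<^sup>2" by (intro power_mono) auto
    also have "\<dots> = K\<^sup>2 * (length w * q)" using q0 by (simp add: power_mult_distrib)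
    also have "\<dots> \<le> L * q" using q0 by (simp add: L_def algebra_simps)
    finally have "(norm y)\<^sup>2 \<le> (1 - 1 / L) * (norm x)\<^sup>2"
      using L by (simp add: q_def field_simps)
    then have "norm y \<le> sqrt ((1 - 1 / L) * (norm x)\<^sup>2)"
      by (rule real_le_rsqrt)
    then show "norm (projector_word U w x) \<le> sqrt (1 - 1 / L) * norm x"
      by (simp add: y_def real_sqrt_mult)
  qed
qed

section \<open>Reflections\<close>

text \<open>
  Together, the two invariants say that the distance to \<open>z\<close> is preserved and that the displacement
  is orthogonal to \<open>z\<close>.
\<close>
lemma reflector_word_invariants:
  fixes U :: "nat \<Rightarrow> 'a::{real_inner, complete_space} set"
  assumes "\<And>i. i \<in> set w \<Longrightarrow> subspace (U i)" "\<And>i. i \<in> set w \<Longrightarrow> closed (U i)"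
    and "\<And>i. i \<in> set w \<Longrightarrow> z \<in> U i"
  shows "norm (reflector_word U w x) = norm x \<and> inner z (reflector_word U w x) = inner z x"
  using assms
proof (induction w arbitrary: x)
  case (Cons i w)
  have Ui: "subspace (U i)" "closed (U i)" "z \<in> U i" using Cons.prems by auto
  have "inner z (reflector (U i) x) = inner z x"
    using projector_orthogonal[OF Ui, of x]
    by (simp add: reflector_def algebra_simps inner_commute)
  moreover have "norm (reflector (U i) x) = norm x"
    using projector_orthogonal[OF Ui(1,2) projector_mem[OF Ui(1,2), of x], of x]
    by (simp add: norm_eq reflector_def algebra_simps inner_commute)
  ultimately show ?case using Cons by simp
qed simp

text \<open>
  Expanding \<open>P = (Id + R) / 2\<close> in every factor produces one product of reflectors for each
  subword of \<open>w\<close>; a subword of an increasing word is increasing.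
\<close>
lemma projector_word_in_affine_hull_reflector_words:
  fixes U :: "nat \<Rightarrow> 'a::{real_inner, complete_space} set"
  assumes "\<And>i. i \<in> set w \<Longrightarrow> subspace (U i)" "\<And>i. i \<in> set w \<Longrightarrow> closed (U i)"
    and "sorted_wrt (<) w"
  shows "projector_word U w x \<in> affine hull
    {reflector_word U v x | v. length v \<le> length w \<and> set v \<subseteq> set w \<and> sorted_wrt (<) v}"
    (is "_ \<in> affine hull ?R w x")
  using assms
proof (induction w arbitrary: x)
  case Nil
  then show ?case by (auto intro!: hull_inc)
next
  case (Cons i w)
  interpret P: bounded_linear "projector_word U w"
    using Cons.prems by (intro bounded_linear_projector_word) auto
  have half: "projector (U i) x = (1/2) *\<^sub>R x + (1/2) *\<^sub>R reflector (U i) x"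
    by (simp add: reflector_def algebra_simps)
  have "projector_word U (i # w) x
      = (1/2) *\<^sub>R projector_word U w x + (1/2) *\<^sub>R projector_word U w (reflector (U i) x)"
    by (simp add: half P.add P.scaleR)
  moreover have "projector_word U w x \<in> affine hull ?R (i # w) x"
  proof -
    have "?R w x \<subseteq> ?R (i # w) x" by (force simp: le_Suc_eq)
    then show ?thesis using Cons hull_mono[of "?R w x" "?R (i # w) x" affine] by auto
  qed
  moreover have "projector_word U w (reflector (U i) x) \<in> affine hull ?R (i # w) x"
  proof -
    have "?R w (reflector (U i) x) \<subseteq> ?R (i # w) x"
    proof clarify
      fix v assume v: "length v \<le> length w" "set v \<subseteq> set w" "sorted_wrt (<) v"
      then have "sorted_wrt (<) (i # v)" using Cons.prems(3) by auto
      with v show "\<exists>v'. reflector_word U v (reflector (U i) x) = reflector_word U v' x \<and>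
          length v' \<le> length (i # w) \<and> set v' \<subseteq> set (i # w) \<and> sorted_wrt (<) v'"
        by (intro exI[of _ "i # v"]) auto
    qed
    then show ?thesis
      using Cons hull_mono[of "?R w (reflector (U i) x)" "?R (i # w) x" affine] by auto
  qed
  ultimately show ?case
    using mem_affine[OF affine_affine_hull, of _ "?R (i # w) x" _ "1/2" "1/2"] by simp
qed

section \<open>The circumcenter as a nearest point\<close>

text \<open>
  By induction, with one Gram--Schmidt step per spanning vector: the residual \<open>e\<close> of the new vector
  supplies the missing orthogonal direction.
\<close>
lemma orthogonal_projection_span_finite:
  fixes x :: "'a::real_inner"
  assumes "finite B"
  shows "\<exists>p\<in>span B. \<forall>y\<in>span B. inner (x - p) y = 0"
  using assms
proof (induction B arbitrary: x)
  case empty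
  then show ?case by simp
next
  case (insert b B)
  obtain p where p: "p \<in> span B" "\<forall>y\<in>span B. inner (x - p) y = 0"
    using insert.IH by blast
  obtain q where q: "q \<in> span B" "\<forall>y\<in>span B. inner (b - q) y = 0"
    using insert.IH by blast
  define e where "e = b - q"
  \<comment> \<open>if \<open>b\<close> already lies in the span, then \<open>e = 0\<close>, \<open>t = 0\<close> and the projection does not change\<close>
  define t where "t = inner (x - p) e / inner e e"
  have in_span: "y \<in> span (insert b B)" if "y \<in> span B" for y
    using that span_mono[of B "insert b B"] by auto
  have e_span: "e \<in> span (insert b B)"
    unfolding e_def using q in_span by (intro span_diff) (auto intro: span_base)
  have e_orth: "inner (x - (p + t *\<^sub>R e)) e = 0"
  proof -
    have "t * inner e e = inner (x - p) e" by (cases "e = 0") (auto simp: t_def)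
    then show ?thesis by (simp add: inner_diff_left inner_add_left)
  qed
  have B_orth: "inner (x - (p + t *\<^sub>R e)) y = 0" if "y \<in> span B" for y
    using p q that by (auto simp: e_def inner_diff_left inner_add_left)
  have "inner (x - (p + t *\<^sub>R e)) y = 0" if y: "y \<in> span (insert b B)" for y
  proof -
    obtain k where k: "y - k *\<^sub>R b \<in> span B" using y span_insert[of b B] by auto
    have "y = (y - k *\<^sub>R b + k *\<^sub>R q) + k *\<^sub>R e" by (simp add: e_def algebra_simps)
    moreover have "y - k *\<^sub>R b + k *\<^sub>R q \<in> span B"
      using k q by (intro span_add span_scale)
    ultimately show ?thesis
      using B_orth e_orth by (metis add.right_neutral inner_add_right inner_scaleR_right mult_zero_right)
  qed
  moreover have "p + t *\<^sub>R e \<in> span (insert b B)"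
    using p in_span e_span by (intro span_add span_scale) auto
  ultimately show ?case by blast
qed

lemma orthogonal_projection_affine_hull_finite:
  fixes z :: "'a::real_inner"
  assumes K: "finite K" "K \<noteq> {}"
  shows "\<exists>p\<in>affine hull K. \<forall>a\<in>affine hull K. \<forall>b\<in>affine hull K. inner (z - p) (a - b) = 0"
proof -
  obtain a where a: "a \<in> K" using K by blast
  define B where "B = (\<lambda>x. x - a) ` K"
  have aff: "(\<lambda>x. x - a) ` (affine hull K) = span B"
    unfolding B_def by (rule diffs_affine_hull_span[OF a])
  obtain v where v: "v \<in> span B" "\<forall>y\<in>span B. inner (z - a - v) y = 0"
    using orthogonal_projection_span_finite[of B "z - a"] K by (auto simp: B_def)
  then have "v \<in> (\<lambda>x. x - a) ` (affine hull K)" by (simp add: aff)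
  then have mem: "a + v \<in> affine hull K" by auto
  have "inner (z - (a + v)) (b - c) = 0" if "b \<in> affine hull K" "c \<in> affine hull K" for b c
  proof -
    have "b - a \<in> span B" "c - a \<in> span B" using that aff by blast+
    then have "(b - a) - (c - a) \<in> span B" by (rule span_diff)
    then show ?thesis using v by (simp add: diff_diff_add)
  qed
  with mem show ?thesis by blast
qed

text \<open>
  Subtracting the equidistance conditions shows that \<open>p - q\<close> is orthogonal to every direction of
  the affine hull, and it is itself such a direction.
\<close>
lemma equidistant_unique_in_affine_hull:
  fixes p q :: "'a::real_inner"
  assumes p: "p \<in> affine hull K" "\<And>a b. a \<in> K \<Longrightarrow> b \<in> K \<Longrightarrow> dist p a = dist p b"
    and q: "q \<in> affine hull K" "\<And>a b. a \<in> K \<Longrightarrow> b \<in> K \<Longrightarrow> dist q a = dist q b"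
  shows "p = q"
proof -
  obtain a where a: "a \<in> K" using p(1) by fastforce
  have "inner (p - q) b = inner (p - q) a" if b: "b \<in> K" for b
  proof -
    have "(dist p a)\<^sup>2 = (dist p b)\<^sup>2" "(dist q a)\<^sup>2 = (dist q b)\<^sup>2"
      using p(2)[OF a b] q(2)[OF a b] by simp_all
    then show ?thesis
      by (simp add: dist_norm power2_norm_eq_inner algebra_simps inner_commute)
  qed
  then have sub: "affine hull K \<subseteq> {y. inner (p - q) y = inner (p - q) a}"
    by (intro hull_minimal affine_hyperplane) auto
  have "inner (p - q) (p - q) = 0"
    using subsetD[OF sub p(1)] subsetD[OF sub q(1)] by (simp add: inner_diff_right[of "p - q"])
  then show ?thesis by simp
qed

text \<open>
  Any point \<open>z\<close> equidistant from the points \<open>T x\<close>, wherever it lies, determines the circumcenter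
  as its nearest point in the affine hull: subtracting the common squared distance from \<open>z\<close> to the
  hull preserves equidistance.
\<close>
lemma circumcenter_map_nearest:
  assumes S: "finite S" "S \<noteq> {}" and eq: "\<And>T. T \<in> S \<Longrightarrow> dist z (T x) = r"
  shows circumcenter_map_in_affine_hull: "circumcenter_map S x \<in> affine hull ((\<lambda>T. T x) ` S)"
    and "y \<in> affine hull ((\<lambda>T. T x) ` S) \<Longrightarrow> dist z (circumcenter_map S x) \<le> dist z y"
proof -
  let ?K = "(\<lambda>T. T x) ` S"
  obtain p where p: "p \<in> affine hull ?K"
    "\<And>a b. a \<in> affine hull ?K \<Longrightarrow> b \<in> affine hull ?K \<Longrightarrow> inner (z - p) (a - b) = 0"
    using orthogonal_projection_affine_hull_finite[of ?K z] S by auto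
  have pyth: "(dist z y)\<^sup>2 = (dist z p)\<^sup>2 + (dist y p)\<^sup>2" if "y \<in> affine hull ?K" for y
    using p that by (intro dist_pythagoras)
  have "dist p a = dist p b" if "a \<in> ?K" "b \<in> ?K" for a b
  proof -
    have "dist z a = dist z b" using that eq by auto
    then have "(dist p a)\<^sup>2 = (dist p b)\<^sup>2"
      using pyth[OF hull_inc[OF that(1)]] pyth[OF hull_inc[OF that(2)]] by (simp add: dist_commute)
    then show ?thesis by simp
  qed
  then have "circumcenter_map S x = p"
    unfolding circumcenter_map_def using p(1)
    by (intro the_equality) (auto intro!: equidistant_unique_in_affine_hull[of _ ?K p])
  moreover have "dist z p \<le> dist z y" if "y \<in> affine hull ?K" for y
    by (rule power2_le_imp_le) (use pyth[OF that] in auto)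
  ultimately show "circumcenter_map S x \<in> affine hull ?K"
    "y \<in> affine hull ?K \<Longrightarrow> dist z (circumcenter_map S x) \<le> dist z y"
    using p(1) by auto
qed

section \<open>Linear convergence of the circumcentered method\<close>

theorem theorem6p6:
  fixes U :: "nat \<Rightarrow> 'a::{real_inner, complete_space} set"
    and m :: nat
    and S :: "('a \<Rightarrow> 'a) set"
    and \<gamma> :: real
  assumes m: "m \<ge> 2"
    and U_subspace: "\<And>i. i \<in> {1..m} \<Longrightarrow> subspace (U i)"
    and U_closed: "\<And>i. i \<in> {1..m} \<Longrightarrow> closed (U i)"
    and sum_closed: "closed (\<Sum>i\<in>{1..m}. orthogonal_comp (U i))"
    and S_finite: "finite S"
    and Psi_S: "Psi U m \<subseteq> S"
    and S_Omega: "S \<subseteq> Omega U m"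
    and gamma: "\<gamma> = onorm (projector_word U [1..<Suc m] \<circ>
                             projector (orthogonal_comp (\<Inter>i\<in>{1..m}. U i)))"
  shows "\<gamma> \<in> {0..<1} \<and>
         (\<forall>x k. norm ((circumcenter_map S ^^ k) x - projector (\<Inter>i\<in>{1..m}. U i) x)
                  \<le> \<gamma> ^ k * norm (x - projector (\<Inter>i\<in>{1..m}. U i) x)) \<and>
         (\<forall>x. converges_with_linear_rate
                (\<lambda>k. (circumcenter_map S ^^ k) x) (projector (\<Inter>i\<in>{1..m}. U i) x) \<gamma>)"
proof -
  define w where "w = [1..<Suc m]"
  define M where "M = (\<Inter>i\<in>{1..m}. U i)"
  have set_w: "set w = {1..m}" by (auto simp: w_def)
  have Uw: "\<And>i. i \<in> set w \<Longrightarrow> subspace (U i)" "\<And>i. i \<in> set w \<Longrightarrow> closed (U i)"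
    using U_subspace U_closed by (auto simp: set_w)
  have M: "subspace M" "closed M"
    using U_subspace U_closed unfolding M_def by (auto intro!: subspace_Inter closed_INT)
  have N: "subspace (orthogonal_comp M)" "closed (orthogonal_comp M)"
    by (auto simp: subspace_orthogonal_comp closed_orthogonal_comp)
  interpret Pw: bounded_linear "projector_word U w"
    by (rule bounded_linear_projector_word[OF Uw])
  define Q where "Q = projector_word U w \<circ> projector (orthogonal_comp M)"
  have Q: "bounded_linear Q"
    unfolding Q_def comp_def
    by (intro bounded_linear_compose[OF Pw.bounded_linear_axioms] bounded_linear_projector N)
  have \<gamma>: "\<gamma> = onorm Q" using gamma by (simp add: Q_def w_def M_def)
  have \<gamma>0: "0 \<le> \<gamma>" unfolding \<gamma> by (rule onorm_pos_le[OF Q])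
  obtain c where c: "0 \<le> c" "c < 1"
    "\<And>x. x \<in> orthogonal_comp M \<Longrightarrow> norm (projector_word U w x) \<le> c * norm x"
  proof (rule projector_word_contraction[of w U])
    show "closed (\<Sum>i\<in>set w. orthogonal_comp (U i))" using sum_closed by (simp only: set_w)
  qed (auto simp: Uw M_def set_w)
  have "\<gamma> \<le> c"
    unfolding \<gamma>
  proof (rule onorm_bound[OF c(1)])
    fix x
    have "norm (Q x) \<le> c * norm (projector (orthogonal_comp M) x)"
      unfolding Q_def comp_def by (intro c projector_mem N)
    also have "\<dots> \<le> c * norm x"
      by (intro mult_left_mono norm_projector_le N c)
    finally show "norm (Q x) \<le> c * norm x" .
  qed
  with c(2) \<gamma>0 have \<gamma>1: "\<gamma> \<in> {0..<1}" by simp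

  have id_S: "reflector_word U [] \<in> S"
    using Psi_S unfolding Psi_def by force
  then have S_ne: "S \<noteq> {}" by blast
  have inv: "norm (T x) = norm x" "inner z (T x) = inner z x" if "T \<in> S" "z \<in> M" for T x z
  proof -
    obtain v where v: "T = reflector_word U v" "set v \<subseteq> {1..m}"
      using S_Omega \<open>T \<in> S\<close> unfolding Omega_def by blast
    then have "norm (reflector_word U v x) = norm x \<and> inner z (reflector_word U v x) = inner z x"
      using U_subspace U_closed \<open>z \<in> M\<close> unfolding M_def
      by (intro reflector_word_invariants) blast+
    then show "norm (T x) = norm x" "inner z (T x) = inner z x" by (simp_all add: v)
  qed
  have equi: "dist z (T x) = dist z x" if "T \<in> S" "z \<in> M" for T x z
  proof -
    have "inner (T x) (T x) = inner x x" using inv(1)[OF that] by (simp add: norm_eq)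
    then show ?thesis
      using inv(2)[OF that, of x] by (simp add: dist_norm norm_eq algebra_simps inner_commute)
  qed
  let ?CC = "circumcenter_map S"
  have P_CC: "projector M (?CC x) = projector M x" for x
  proof (rule projector_eqI[OF M(1) projector_mem[OF M]])
    fix z assume z: "z \<in> M"
    have "affine hull ((\<lambda>T. T x) ` S) \<subseteq> {y. inner z y = inner z x}"
      using inv(2)[OF _ z] by (intro hull_minimal affine_hyperplane) auto
    moreover have "?CC x \<in> affine hull ((\<lambda>T. T x) ` S)"
      using equi[OF _ z]
      by (intro circumcenter_map_in_affine_hull[where z = z and r = "dist z x"] S_finite S_ne)
    ultimately have "inner z (?CC x) = inner z x" by blast
    then show "inner (?CC x - projector M x) z = 0"
      using projector_orthogonal[OF M z, of x] by (simp add: inner_diff_right inner_commute)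
  qed
  have step: "norm (?CC x - projector M x) \<le> \<gamma> * norm (x - projector M x)" for x
  proof -
    define z where "z = projector M x"
    have z: "z \<in> M" unfolding z_def by (rule projector_mem[OF M])
    have len_w: "length w = m" by (simp add: w_def)
    have sorted_w: "sorted_wrt (<) w" unfolding w_def by (rule sorted_wrt_upt)
    have "{reflector_word U v x | v. length v \<le> length w \<and> set v \<subseteq> set w \<and> sorted_wrt (<) v}
        \<subseteq> (\<lambda>T. T x) ` S"
      using Psi_S unfolding Psi_def set_w len_w by blast
    then have "projector_word U w x \<in> affine hull ((\<lambda>T. T x) ` S)"
      using projector_word_in_affine_hull_reflector_words[of w U x, OF Uw sorted_w]
      by (meson hull_mono subsetD)
    then have "dist z (?CC x) \<le> dist z (projector_word U w x)"
      using equi[OF _ z]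
      by (intro circumcenter_map_nearest(2)[where r = "dist z x"] S_finite S_ne)
    also have "dist z (projector_word U w x) = norm (projector_word U w x - projector_word U w z)"
      using projector_word_ident[of w U z] Uw z
      by (simp add: M_def set_w dist_norm norm_minus_commute)
    also have "\<dots> = norm (Q (x - z))"
      using diff_projector_orthogonal_comp[OF M, of x]
      by (simp add: Q_def z_def projector_ident[OF N(1)] Pw.diff)
    also have "\<dots> \<le> \<gamma> * norm (x - z)" unfolding \<gamma> by (rule onorm[OF Q])
    finally show ?thesis by (simp add: z_def dist_norm norm_minus_commute)
  qed
  have P_iter: "projector M ((?CC ^^ k) x) = projector M x" for x k
    by (induction k) (auto simp: P_CC)
  have rate: "norm ((?CC ^^ k) x - projector M x) \<le> \<gamma> ^ k * norm (x - projector M x)" for x k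
  proof (induction k)
    case (Suc k)
    have "norm ((?CC ^^ Suc k) x - projector M x) \<le> \<gamma> * norm ((?CC ^^ k) x - projector M x)"
      using step[of "(?CC ^^ k) x"] by (simp add: P_iter)
    also have "\<dots> \<le> \<gamma> * (\<gamma> ^ k * norm (x - projector M x))"
      by (intro mult_left_mono Suc \<gamma>0)
    finally show ?case by (simp add: mult.assoc)
  qed simp
  have "(\<lambda>k. (?CC ^^ k) x) \<longlonglongrightarrow> projector M x" for x
  proof (rule LIM_zero_cancel, rule Lim_null_comparison)
    have "(\<lambda>k. \<gamma> ^ k * norm (x - projector M x)) \<longlonglongrightarrow> 0 * norm (x - projector M x)"
      using \<gamma>1 by (intro tendsto_intros LIMSEQ_realpow_zero) auto
    then show "(\<lambda>k. \<gamma> ^ k * norm (x - projector M x)) \<longlonglongrightarrow> 0" by simp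
    show "\<forall>\<^sub>F k in sequentially. norm ((?CC ^^ k) x - projector M x)
        \<le> \<gamma> ^ k * norm (x - projector M x)"
      using rate by simp
  qed
  then show ?thesis
    using \<gamma>1 rate unfolding converges_with_linear_rate_def M_def[symmetric] by auto
qed

end
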